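(* Let $d\in\{1,2\}$. There exists an absolute constant $c>0$ such that for all $T>0$ and all Borel $V:\mathbb{R}^d\to\mathbb{R}$, $$c^{-1}\sup_{x\in\mathbb{R}^d}\int_0^T\int_{\mathbb{R}^d}g(s,x,z)|V(z)|\,dz\,ds\le\|S(V)\|_{T,\infty}\le c\sup_{x\in\mathbb{R}^d}\int_0^T\int_{\mathbb{R}^d}g(s,x,z)|V(z)|\,dz\,ds.$$
   Context: $g(t,x,y)=(4\pi t)^{-d/2}e^{-|y-x|^2/(4t)}$. $S(V,t,x,y)=\int_0^t\int_{\mathbb{R}^d}\frac{g(s,x,z)g(t-s,z,y)}{g(t,x,y)}|V(z)|\,dz\,ds$, $\|S(V,t)\|_\infty=\sup_{x,y\in\mathbb{R}^d}S(V,t,x,y)$, $\|S(V)\|_{T,\infty}=\sup_{0<t\le T}\|S(V,t)\|_\infty$. *)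

theory Defs
  imports "HOL-Analysis.Analysis"
begin

definition heat_g :: "real \<Rightarrow> 'a::euclidean_space \<Rightarrow> 'a \<Rightarrow> real" where
  "heat_g t x y = (4 * pi * t) powr (- (real DIM('a) / 2)) * exp (- (norm (y - x))\<^sup>2 / (4 * t))"

definition S_fun :: "('a::euclidean_space \<Rightarrow> real) \<Rightarrow> real \<Rightarrow> 'a \<Rightarrow> 'a \<Rightarrow> ennreal" where
  "S_fun V t x y =
     (\<integral>\<^sup>+ s \<in> {0..t}. (\<integral>\<^sup>+ z. ennreal (heat_g s x z * heat_g (t - s) z y / heat_g t x y * \<bar>V z\<bar>) \<partial>lborel) \<partial>lborel)"

definition S_sup :: "('a::euclidean_space \<Rightarrow> real) \<Rightarrow> real \<Rightarrow> ennreal" where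
  "S_sup V t = (SUP x. SUP y. S_fun V t x y)"

definition S_norm :: "('a::euclidean_space \<Rightarrow> real) \<Rightarrow> real \<Rightarrow> ennreal" where
  "S_norm V T = (SUP t \<in> {0<..T}. S_sup V t)"

definition heat_pot :: "('a::euclidean_space \<Rightarrow> real) \<Rightarrow> real \<Rightarrow> ennreal" where
  "heat_pot V T = (SUP x. \<integral>\<^sup>+ s \<in> {0..T}. (\<integral>\<^sup>+ z. ennreal (heat_g s x z * \<bar>V z\<bar>) \<partial>lborel) \<partial>lborel)"

end

theory Submission
  imports Defs "HOL-Probability.Distributions"
begin

text \<open>Averaging \<open>S(V,T,x,y)\<close> against \<open>g(T,x,y) dy\<close> gives the lower bound with constant 1.

For the upper bound, \<open>g(s,x,z) g(t-s,z,y) / g(t,x,y)\<close> is the density at \<open>z\<close> of a Brownian bridge,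
i.e. \<open>g(s(t-s)/t, x + s w, z)\<close> with \<open>w = (y-x)/t\<close>. For \<open>s \<le> t/2\<close> this is at most
\<open>2 g(s, x + s w, z)\<close>, and \<open>s \<ge> t/2\<close> is symmetric, so the potential of Brownian motion with drift \<open>w\<close>
has to be bounded uniformly in \<open>w\<close> by \<open>M = sup\<^sub>x \<integral>\<^sub>0\<^sup>t \<integral> g(s,x,z) |V(z)| dz ds\<close>. The basic input is
\<open>\<integral> g(2t,a,z) |V(z)| dz \<le> 4 M / t\<close> for all \<open>a\<close>. In dimension 1 it suffices, as \<open>g(s,a,\<cdot>) \<le> 2 (t/s)\<^sup>1\<^sup>/\<^sup>2 g(2t,a,\<cdot>)\<close>.
In dimension 2 the drift is negligible as long as \<open>s |w|\<^sup>2 \<le> 1\<close>; for larger \<open>s\<close> the drifted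
kernel integrated in \<open>s\<close> is dominated by \<open>t\<close> times a superposition of the Gaussians \<open>g(2t,a,\<cdot>)\<close> with \<open>a\<close>
distributed on the segment from \<open>x\<close> to \<open>x + t w\<close> with total mass \<open>O(1)\<close>: unit masses at both
end points and density \<open>(s t)\<^sup>-\<^sup>1\<^sup>/\<^sup>2 ds\<close> at \<open>a = x + s w\<close>.\<close>

section \<open>The Gauss kernel: positivity, total mass and the Brownian bridge identity\<close>

lemma heat_g_nonneg [simp]: "0 \<le> heat_g t x y"
  by (simp add: heat_g_def)

lemma heat_g_pos: "0 < t \<Longrightarrow> 0 < heat_g t x y"
  by (simp add: heat_g_def)

lemma heat_g_commute: "heat_g t x y = heat_g t y x"
  by (simp add: heat_g_def norm_minus_commute)

lemma borel_measurable_heat_g [measurable]: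
  fixes g h :: "'b \<Rightarrow> 'a::euclidean_space"
  assumes [measurable]: "f \<in> borel_measurable M" "g \<in> borel_measurable M" "h \<in> borel_measurable M"
  shows "(\<lambda>w. heat_g (f w) (g w) (h w)) \<in> borel_measurable M"
  unfolding heat_g_def by measurable

text \<open>The exponent \<open>4 * t\<close> is twice the variance, so each coordinate has standard
  deviation \<open>sqrt (2 * t)\<close>. The product form reduces the total mass to one-dimensional
  normal densities.\<close>

lemma heat_g_eq_prod_normal_density:
  fixes x y :: "'a::euclidean_space"
  assumes "0 < t"
  shows "heat_g t x y = (\<Prod>b\<in>Basis. normal_density (x \<bullet> b) (sqrt (2 * t)) (y \<bullet> b))"
proof -
  have "(\<Prod>b\<in>(Basis::'a set). normal_density (x \<bullet> b) (sqrt (2 * t)) (y \<bullet> b))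
      = (\<Prod>b\<in>(Basis::'a set). (4 * pi * t) powr (- 1 / 2) * exp (- ((y - x) \<bullet> b)\<^sup>2 / (4 * t)))"
    using assms
    by (intro prod.cong)
       (simp_all add: normal_density_def powr_minus_divide powr_half_sqrt inner_diff_left mult_ac)
  also have "\<dots> = ((4 * pi * t) powr (- 1 / 2)) ^ DIM('a) * exp (\<Sum>b\<in>(Basis::'a set). - ((y - x) \<bullet> b)\<^sup>2 / (4 * t))"
    by (simp add: prod.distrib exp_sum)
  also have "((4 * pi * t) powr (- 1 / 2)) ^ DIM('a) = (4 * pi * t) powr (- (real DIM('a) / 2))"
    using assms by (simp add: powr_realpow[symmetric] powr_powr)
  also have "(\<Sum>b\<in>(Basis::'a set). - ((y - x) \<bullet> b)\<^sup>2 / (4 * t)) = - (norm (y - x))\<^sup>2 / (4 * t)"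
    unfolding power2_norm_eq_inner euclidean_inner[of "y - x" "y - x"]
    by (simp add: sum_negf sum_divide_distrib power2_eq_square)
  finally show ?thesis by (simp add: heat_g_def)
qed

lemma nn_integral_heat_g:
  fixes x :: "'a::euclidean_space"
  assumes "0 < t"
  shows "(\<integral>\<^sup>+y. ennreal (heat_g t x y) \<partial>lborel) = 1"
proof -
  have one: "(\<integral>\<^sup>+u. ennreal (normal_density m (sqrt (2 * t)) u) \<partial>lborel) = 1" for m
    using assms by (subst nn_integral_eq_integral) auto
  have "(\<integral>\<^sup>+y. ennreal (heat_g t x y) \<partial>lborel)
      = (\<integral>\<^sup>+y. (\<Prod>b\<in>(Basis::'a set). ennreal (normal_density (x \<bullet> b) (sqrt (2 * t)) (y \<bullet> b))) \<partial>lborel)"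
    using assms by (simp add: heat_g_eq_prod_normal_density prod_ennreal)
  also have "\<dots> = 1"
    by (subst nn_integral_lborel_prod) (auto simp: one)
  finally show ?thesis .
qed

text \<open>Completing the square in \<open>z\<close>, with prefactors combining by multiplicativity
  of \<open>powr\<close>. The right side is a probability density in \<open>z\<close>, which yields
  both the semigroup law and the drift picture of the bridge.\<close>

lemma heat_g_bridge:
  fixes x y z :: "'a::euclidean_space"
  assumes "0 < s" "s < t"
  shows "heat_g s x z * heat_g (t - s) z y / heat_g t x y
       = heat_g (s * (t - s) / t) (x + (s / t) *\<^sub>R (y - x)) z"
proof -
  define a b where "a = z - x" and "b = y - x"
  have "(norm a)\<^sup>2 / (4 * s) + (norm (b - a))\<^sup>2 / (4 * (t - s)) - (norm b)\<^sup>2 / (4 * t)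
      = (norm (a - (s / t) *\<^sub>R b))\<^sup>2 / (4 * (s * (t - s) / t))"
    using assms unfolding power2_norm_eq_inner
    apply (simp add: inner_diff_left inner_diff_right inner_commute divide_simps)
    apply (simp add: power2_eq_square algebra_simps)
    done
  then have e: "exp (- (norm a)\<^sup>2 / (4 * s)) * exp (- (norm (b - a))\<^sup>2 / (4 * (t - s))) / exp (- (norm b)\<^sup>2 / (4 * t))
      = exp (- (norm (a - (s / t) *\<^sub>R b))\<^sup>2 / (4 * (s * (t - s) / t)))"
    by (simp add: exp_add[symmetric] exp_diff[symmetric])
  have p: "(4 * pi * s) powr q * (4 * pi * (t - s)) powr q / (4 * pi * t) powr q = (4 * pi * (s * (t - s) / t)) powr q" for q
  proof -
    have "(4 * pi * s) powr q * (4 * pi * (t - s)) powr q / (4 * pi * t) powr q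
        = ((4 * pi * s) * (4 * pi * (t - s)) / (4 * pi * t)) powr q"
      using assms by (simp add: powr_mult powr_divide)
    also have "(4 * pi * s) * (4 * pi * (t - s)) / (4 * pi * t) = 4 * pi * (s * (t - s) / t)"
      using assms by simp
    finally show ?thesis .
  qed
  have vec: "y - z = b - a" "z - (x + (s / t) *\<^sub>R b) = a - (s / t) *\<^sub>R b"
    by (simp_all add: a_def b_def)
  show ?thesis
    unfolding heat_g_def vec a_def[symmetric] b_def[symmetric] e[symmetric] p[symmetric]
    by (simp only: times_divide_times_eq mult_ac)
qed

section \<open>The heat semigroup applied to the modulus of \<open>V\<close>\<close>

definition pot :: "('a::euclidean_space \<Rightarrow> real) \<Rightarrow> real \<Rightarrow> 'a \<Rightarrow> ennreal" where
  "pot V s x = (\<integral>\<^sup>+z. ennreal (heat_g s x z * \<bar>V z\<bar>) \<partial>lborel)"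

lemma borel_measurable_pot [measurable]:
  fixes V :: "'a::euclidean_space \<Rightarrow> real"
  assumes [measurable]: "V \<in> borel_measurable borel" "f \<in> borel_measurable M" "g \<in> borel_measurable M"
  shows "(\<lambda>w. pot V (f w) (g w)) \<in> borel_measurable M"
  unfolding pot_def by measurable

lemma heat_pot_eq: "heat_pot V T = (SUP x. \<integral>\<^sup>+s\<in>{0..T}. pot V s x \<partial>lborel)"
  by (simp add: heat_pot_def pot_def)

lemma pot_integral_le_heat_pot: "(\<integral>\<^sup>+s\<in>{0..T}. pot V s x \<partial>lborel) \<le> heat_pot V T"
  unfolding heat_pot_eq by (rule SUP_upper) simp

lemma heat_pot_mono: "t \<le> T \<Longrightarrow> heat_pot V t \<le> heat_pot V T"
  unfolding heat_pot_eq
  by (intro SUP_mono' nn_integral_mono mult_left_mono) (auto split: split_indicator)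

text \<open>Semigroup law. By the bridge identity, \<open>heat_g r x a * heat_g s a z\<close> is
  \<open>heat_g (r + s) x z\<close> times a probability density in \<open>a\<close>; Tonelli then
  moves the \<open>a\<close>-integral inside.\<close>

lemma pot_add:
  fixes V :: "'a::euclidean_space \<Rightarrow> real"
  assumes [measurable]: "V \<in> borel_measurable borel" and "0 < r" "0 < s"
  shows "pot V (r + s) x = (\<integral>\<^sup>+a. ennreal (heat_g r x a) * pot V s a \<partial>lborel)"
proof -
  have conv: "(\<integral>\<^sup>+a. ennreal (heat_g r x a * heat_g s a z) \<partial>lborel) = ennreal (heat_g (r + s) x z)" for z
  proof -
    have "heat_g r x a * heat_g s a z = heat_g (r + s) x z * heat_g (r * s / (r + s)) (x + (r / (r + s)) *\<^sub>R (z - x)) a" for a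
      using heat_g_bridge[of r "r + s" x a z] assms heat_g_pos[of "r + s" x z]
      by (simp add: field_simps)
    then show ?thesis
      using assms by (simp add: ennreal_mult nn_integral_cmult nn_integral_heat_g)
  qed
  have "(\<integral>\<^sup>+a. ennreal (heat_g r x a) * pot V s a \<partial>lborel)
      = (\<integral>\<^sup>+a. \<integral>\<^sup>+z. ennreal (heat_g r x a * heat_g s a z) * ennreal \<bar>V z\<bar> \<partial>lborel \<partial>lborel)"
    unfolding pot_def by (subst nn_integral_cmult[symmetric]) (auto simp: ennreal_mult mult_ac)
  also have "\<dots> = (\<integral>\<^sup>+z. \<integral>\<^sup>+a. ennreal (heat_g r x a * heat_g s a z) * ennreal \<bar>V z\<bar> \<partial>lborel \<partial>lborel)"
    by (rule lborel_pair.Fubini') measurable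
  also have "\<dots> = (\<integral>\<^sup>+z. (\<integral>\<^sup>+a. ennreal (heat_g r x a * heat_g s a z) \<partial>lborel) * ennreal \<bar>V z\<bar> \<partial>lborel)"
    by (intro nn_integral_cong nn_integral_multc) measurable
  also have "\<dots> = pot V (r + s) x"
    unfolding conv pot_def by (simp add: ennreal_mult)
  finally show ?thesis ..
qed

text \<open>Time reversal of the bridge: it later turns the second half of the time interval into
  the first half with the end points exchanged.\<close>

lemma bridge_kernel_commute:
  "heat_g s x z * heat_g (t - s) z y / heat_g t x y = heat_g (t - s) y z * heat_g s z x / heat_g t y x"
  by (metis heat_g_commute mult.commute)

section \<open>Lower bound by averaging over the end point\<close>

lemma heat_pot_le_S_norm:
  fixes V :: "'a::euclidean_space \<Rightarrow> real"
  assumes [measurable]: "V \<in> borel_measurable borel" and "0 < T"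
  shows "heat_pot V T \<le> S_norm V T"
  unfolding heat_pot_eq
proof (rule SUP_least)
  fix x :: 'a
  have "(\<integral>\<^sup>+s\<in>{0..T}. pot V s x \<partial>lborel) = (\<integral>\<^sup>+s\<in>{0..T}. (\<integral>\<^sup>+y. \<integral>\<^sup>+z. ennreal (heat_g s x z * heat_g (T - s) z y * \<bar>V z\<bar>) \<partial>lborel \<partial>lborel) \<partial>lborel)"
  proof (rule nn_integral_cong_AE)
    show "AE s in lborel. pot V s x * indicator {0..T} s = (\<integral>\<^sup>+y. \<integral>\<^sup>+z. ennreal (heat_g s x z * heat_g (T - s) z y * \<bar>V z\<bar>) \<partial>lborel \<partial>lborel) * indicator {0..T} s"
      \<comment> \<open>The null set \<open>s = T\<close> is removed because \<open>heat_g 0\<close>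
        is identically 0 (\<open>0 powr _ = 0\<close>) and so does not have mass 1. At
        \<open>s = 0\<close> both sides vanish for the same reason.\<close>
      using AE_lborel_singleton[of T]
    proof eventually_elim
      case (elim s)
      show ?case
      proof (cases "s \<in> {0..T}")
        case True
        with elim have "s < T" by auto
        have "(\<integral>\<^sup>+y. \<integral>\<^sup>+z. ennreal (heat_g s x z * heat_g (T - s) z y * \<bar>V z\<bar>) \<partial>lborel \<partial>lborel)
            = (\<integral>\<^sup>+z. \<integral>\<^sup>+y. ennreal (heat_g s x z * \<bar>V z\<bar>) * ennreal (heat_g (T - s) z y) \<partial>lborel \<partial>lborel)"
          by (subst lborel_pair.Fubini') (auto simp: ennreal_mult mult_ac)
        also have "\<dots> = pot V s x"
          using \<open>s < T\<close> by (simp add: nn_integral_cmult nn_integral_heat_g pot_def)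
        finally show ?thesis by simp
      qed simp
    qed
  qed
  also have "\<dots> = (\<integral>\<^sup>+s. \<integral>\<^sup>+y. (\<integral>\<^sup>+z. ennreal (heat_g s x z * heat_g (T - s) z y * \<bar>V z\<bar>) \<partial>lborel) * indicator {0..T} s \<partial>lborel \<partial>lborel)"
    by (simp add: nn_integral_multc)
  also have "\<dots> = (\<integral>\<^sup>+y. \<integral>\<^sup>+s. (\<integral>\<^sup>+z. ennreal (heat_g s x z * heat_g (T - s) z y * \<bar>V z\<bar>) \<partial>lborel) * indicator {0..T} s \<partial>lborel \<partial>lborel)"
    by (rule lborel_pair.Fubini') measurable
  also have "\<dots> = (\<integral>\<^sup>+y. ennreal (heat_g T x y) * S_fun V T x y \<partial>lborel)"
  proof (rule nn_integral_cong)
    fix y :: 'a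
    \<comment> \<open>The weight \<open>heat_g T x y\<close> cancels the denominator of the bridge
      kernel, so the \<open>y\<close>-integrand becomes an average of \<open>S_fun V T x y\<close>
      against a probability density.\<close>
    have "heat_g s x z * heat_g (T - s) z y * \<bar>V z\<bar> = heat_g T x y * (heat_g s x z * heat_g (T - s) z y / heat_g T x y * \<bar>V z\<bar>)" for s z
      using heat_g_pos[OF \<open>0 < T\<close>, of x y] by simp
    then have "ennreal (heat_g s x z * heat_g (T - s) z y * \<bar>V z\<bar>) = ennreal (heat_g T x y) * ennreal (heat_g s x z * heat_g (T - s) z y / heat_g T x y * \<bar>V z\<bar>)" for s z
      by (metis ennreal_mult' heat_g_nonneg)
    then show "(\<integral>\<^sup>+s. (\<integral>\<^sup>+z. ennreal (heat_g s x z * heat_g (T - s) z y * \<bar>V z\<bar>) \<partial>lborel) * indicator {0..T} s \<partial>lborel) = ennreal (heat_g T x y) * S_fun V T x y"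
      unfolding S_fun_def by (simp add: nn_integral_cmult mult.assoc)
  qed
  also have "\<dots> \<le> (\<integral>\<^sup>+y. ennreal (heat_g T x y) * S_norm V T \<partial>lborel)"
  proof (intro nn_integral_mono mult_left_mono)
    fix y
    have "S_fun V T x y \<le> S_sup V T"
      unfolding S_sup_def by (intro SUP_upper2[of x] SUP_upper2[of y]) auto
    also have "\<dots> \<le> S_norm V T"
      unfolding S_norm_def using \<open>0 < T\<close> by (intro SUP_upper) auto
    finally show "S_fun V T x y \<le> S_norm V T" .
  qed simp
  also have "\<dots> = S_norm V T"
    using \<open>0 < T\<close> by (simp add: nn_integral_multc nn_integral_heat_g)
  finally show "(\<integral>\<^sup>+s\<in>{0..T}. pot V s x \<partial>lborel) \<le> S_norm V T" .
qed

section \<open>The semigroup at times beyond \<open>t / 2\<close> is bounded by the time-integrated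
  potential\<close>

text \<open>The exponential grows with time, and the prefactor drops by at most
  \<open>2 powr (d / 2)\<close> with \<open>d = DIM('a)\<close>, which is at most 2 in dimensions up
  to 2.\<close>

lemma heat_g_le_dilate:
  fixes x z :: "'a::euclidean_space"
  assumes "0 < s" "s \<le> r" "r \<le> 2 * s" "DIM('a) \<le> 2"
  shows "heat_g s x z \<le> 2 * heat_g r x z"
proof -
  have "(4 * pi * s) powr (- (real DIM('a) / 2)) \<le> 2 * (4 * pi * r) powr (- (real DIM('a) / 2))"
  proof -
    have "(4 * pi * s) powr (- (real DIM('a) / 2)) \<le> (4 * pi * (r / 2)) powr (- (real DIM('a) / 2))"
      using assms by (intro powr_mono2') auto
    also have "\<dots> = 2 powr (real DIM('a) / 2) * (4 * pi * r) powr (- (real DIM('a) / 2))"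
      using assms powr_divide[of "4 * pi * r" 2 "- (real DIM('a) / 2)"] by (simp add: powr_minus divide_simps)
    also have "\<dots> \<le> 2 * (4 * pi * r) powr (- (real DIM('a) / 2))"
      using assms powr_mono[of "real DIM('a) / 2" 1 2] by (intro mult_right_mono) auto
    finally show ?thesis .
  qed
  moreover have "exp (- (norm (z - x))\<^sup>2 / (4 * s)) \<le> exp (- (norm (z - x))\<^sup>2 / (4 * r))"
    using assms by (auto intro!: divide_left_mono mult_pos_pos)
  ultimately show ?thesis
    unfolding heat_g_def mult.assoc[symmetric] by (intro mult_mono) auto
qed

text \<open>At time \<open>t / 2\<close> the value is at most twice that at any \<open>s\<close> in
  \<open>{t / 2..t}\<close>; averaging over this interval of length \<open>t / 2\<close> gives the
  factor \<open>4 / t\<close>. The bound is uniform in the centre, so the semigroup law carries it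
  to every later time.\<close>

lemma pot_le_heat_pot:
  fixes V :: "'a::euclidean_space \<Rightarrow> real"
  assumes [measurable]: "V \<in> borel_measurable borel" and "0 < t" "t / 2 < r" "DIM('a) \<le> 2"
  shows "pot V r x \<le> ennreal (4 / t) * heat_pot V t"
proof -
  have half: "pot V (t / 2) a \<le> ennreal (4 / t) * heat_pot V t" for a
  proof -
    have lower: "pot V (t / 2) a \<le> 2 * pot V s a" if "s \<in> {t / 2..t}" for s
    proof -
      have "pot V (t / 2) a \<le> (\<integral>\<^sup>+z. 2 * ennreal (heat_g s a z * \<bar>V z\<bar>) \<partial>lborel)"
        unfolding pot_def
      proof (intro nn_integral_mono)
        fix z
        have "heat_g (t / 2) a z * \<bar>V z\<bar> \<le> 2 * (heat_g s a z * \<bar>V z\<bar>)"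
          using heat_g_le_dilate[of "t / 2" s a z] that assms mult_right_mono[of "heat_g (t / 2) a z" "2 * heat_g s a z" "\<bar>V z\<bar>"] by simp
        then show "ennreal (heat_g (t / 2) a z * \<bar>V z\<bar>) \<le> 2 * ennreal (heat_g s a z * \<bar>V z\<bar>)"
          by (metis ennreal_leI ennreal_mult' ennreal_numeral zero_le_numeral)
      qed
      then show ?thesis by (simp add: nn_integral_cmult pot_def)
    qed
    have "ennreal (t / 2) * pot V (t / 2) a = (\<integral>\<^sup>+s\<in>{t / 2..t}. pot V (t / 2) a \<partial>lborel)"
      using assms by (simp add: nn_integral_cmult mult.commute)
    also have "\<dots> \<le> (\<integral>\<^sup>+s. 2 * (pot V s a * indicator {0..t} s) \<partial>lborel)"
      using lower assms by (intro nn_integral_mono) (auto split: split_indicator)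
    also have "\<dots> \<le> 2 * heat_pot V t"
      by (simp add: nn_integral_cmult mult_left_mono pot_integral_le_heat_pot)
    finally have "ennreal (2 / t) * (ennreal (t / 2) * pot V (t / 2) a) \<le> ennreal (2 / t) * (2 * heat_pot V t)"
      by (rule mult_left_mono) simp
    moreover have "ennreal (2 / t) * ennreal (t / 2) = 1"
      using assms by (simp add: ennreal_mult[symmetric])
    moreover have "ennreal (2 / t) * 2 = ennreal (4 / t)"
      using assms by (metis ennreal_mult'' ennreal_numeral mult.commute times_divide_eq_right mult_2 numeral_Bit0 zero_le_numeral)
    ultimately show ?thesis
      by (simp add: mult.assoc[symmetric])
  qed
  have "pot V r x = pot V ((r - t / 2) + t / 2) x" by simp
  also have "\<dots> = (\<integral>\<^sup>+a. ennreal (heat_g (r - t / 2) x a) * pot V (t / 2) a \<partial>lborel)"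
    using assms by (intro pot_add) auto
  also have "\<dots> \<le> (\<integral>\<^sup>+a. ennreal (heat_g (r - t / 2) x a) * (ennreal (4 / t) * heat_pot V t) \<partial>lborel)"
    by (intro nn_integral_mono mult_left_mono half) simp
  also have "\<dots> = ennreal (4 / t) * heat_pot V t"
    using assms by (simp add: nn_integral_multc nn_integral_heat_g)
  finally show ?thesis .
qed

section \<open>Scalar integrals in time and the one-dimensional drift kernel\<close>

lemma ennreal_numeral_mult: "ennreal (numeral n * x) = numeral n * ennreal x"
  by (simp add: ennreal_mult')

lemma nn_integral_Icc_le_antiderivative:
  fixes F F' h :: "real \<Rightarrow> real"
  assumes "a \<le> b"
    and F: "\<And>s. s \<in> {a..b} \<Longrightarrow> (F has_real_derivative F' s) (at s)"
    and h: "\<And>s. s \<in> {a..b} \<Longrightarrow> 0 \<le> h s \<and> h s \<le> F' s"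
  shows "(\<integral>\<^sup>+s\<in>{a..b}. ennreal (h s) \<partial>lborel) \<le> ennreal (F b - F a)"
proof -
  have "(F' has_integral (F b - F a)) {a..b}"
    using assms(1) F
    by (intro fundamental_theorem_of_calculus)
       (auto simp: has_real_derivative_iff_has_vector_derivative[symmetric] intro: has_field_derivative_at_within)
  moreover have "0 \<le> F' s" if "s \<in> {a..b}" for s
    using h[OF that] by linarith
  ultimately have "(\<integral>\<^sup>+s\<in>{a..b}. ennreal (F' s) \<partial>lborel) = ennreal (F b - F a)"
    by (intro nn_integral_has_integral_lebesgue') auto
  moreover have "(\<integral>\<^sup>+s\<in>{a..b}. ennreal (h s) \<partial>lborel) \<le> (\<integral>\<^sup>+s\<in>{a..b}. ennreal (F' s) \<partial>lborel)"
    using h by (intro nn_integral_mono) (auto split: split_indicator intro: ennreal_leI)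
  ultimately show ?thesis by simp
qed

text \<open>This is the total mass of the density placed along the drift segment, and also the time
  integral that settles dimension 1.\<close>

lemma nn_integral_inverse_sqrt:
  assumes "0 < t"
  shows "(\<integral>\<^sup>+s\<in>{0..t}. ennreal (1 / sqrt (s * t)) \<partial>lborel) = 2"
proof -
  have "((\<lambda>s. s powr (- 1 / 2)) has_integral (t powr (- 1 / 2 + 1) / (- 1 / 2 + 1))) {0..t}"
    using assms by (intro has_integral_powr_from_0) auto
  then have "((\<lambda>s. s powr (- 1 / 2) * (1 / sqrt t)) has_integral (t powr (- 1 / 2 + 1) / (- 1 / 2 + 1)) * (1 / sqrt t)) {0..t}"
    by (rule has_integral_mult_left)
  moreover have "(t powr (- 1 / 2 + 1) / (- 1 / 2 + 1)) * (1 / sqrt t) = 2"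
    using assms by (simp add: powr_half_sqrt)
  ultimately have "((\<lambda>s. s powr (- 1 / 2) * (1 / sqrt t)) has_integral 2) {0..t}"
    by simp
  moreover have "s powr (- 1 / 2) * (1 / sqrt t) = 1 / sqrt (s * t)" if "s \<in> {0..t}" for s
    using that by (simp add: real_sqrt_mult powr_minus_divide powr_half_sqrt)
  ultimately have "((\<lambda>s. 1 / sqrt (s * t)) has_integral 2) {0..t}"
    by (rule has_integral_eq[rotated])
  from nn_integral_has_integral_lebesgue'[OF _ this] show ?thesis
    using assms by simp
qed

text \<open>With \<open>u\<close> the square of \<open>f s\<close>, the Gaussian is traded for the
  factor \<open>1 / (1 + u)\<close> occurring in the derivative of
  \<open>arctan (f s)\<close>.\<close>

lemma exp_minus_div_8_le:
  fixes u :: real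
  assumes "0 \<le> u"
  shows "exp (- (u / 8)) \<le> 8 / (1 + u)"
proof -
  have "(1 + u) / 8 \<le> 1 + u / 8"
    by (simp add: field_simps)
  also have "\<dots> \<le> exp (u / 8)"
    by (rule exp_ge_add_one_self)
  finally have "inverse (exp (u / 8)) \<le> inverse ((1 + u) / 8)"
    using assms by (intro le_imp_inverse_le) auto
  then show ?thesis
    by (simp add: exp_minus inverse_eq_divide)
qed

text \<open>For \<open>f s = (\<zeta> - s * v) / sqrt s\<close> the arithmetic-geometric mean inequality gives
  \<open>\<bar>f' s\<bar> \<ge> sqrt (\<zeta> * v) / s\<close>, so the integrand is dominated by a
  multiple of the derivative of \<open>- arctan \<circ> f\<close>.\<close>

lemma nn_integral_drift_kernel_le:
  assumes "0 < \<zeta>" "0 < v" "0 < a" "a \<le> t"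
  shows "(\<integral>\<^sup>+s\<in>{a..t}. ennreal (exp (- (\<zeta> - s * v)\<^sup>2 / (8 * s)) / s) \<partial>lborel) \<le> ennreal (26 / sqrt (\<zeta> * v))"
proof -
  define f where "f s = (\<zeta> - s * v) / sqrt s" for s
  define f' where "f' s = - (\<zeta> + s * v) / (2 * s * sqrt s)" for s
  define F where "F s = - 8 * arctan (f s) / sqrt (\<zeta> * v)" for s
  define F' where "F' s = - 8 * f' s / (1 + (f s)\<^sup>2) / sqrt (\<zeta> * v)" for s
  have f: "(f has_real_derivative f' s) (at s)" if "0 < s" for s
  proof -
    have "(f has_real_derivative ((- v) * sqrt s - (\<zeta> - s * v) * (inverse (sqrt s) / 2)) / (sqrt s * sqrt s)) (at s)"
      unfolding f_def using that by (auto intro!: derivative_eq_intros)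
    also have "((- v) * sqrt s - (\<zeta> - s * v) * (inverse (sqrt s) / 2)) / (sqrt s * sqrt s) = f' s"
    proof -
      \<comment> \<open>Writing \<open>s\<close> as the square of \<open>r\<close> makes the
        derivative formula a rational identity.\<close>
      obtain r where r: "0 < r" "s = r\<^sup>2" "sqrt s = r"
        using \<open>0 < s\<close> by (metis real_sqrt_gt_0_iff real_sqrt_pow2 less_imp_le)
      show ?thesis
        unfolding f'_def r(3) using r(1) unfolding r(2) by (simp add: field_simps power2_eq_square)
    qed
    finally show ?thesis .
  qed
  have F: "(F has_real_derivative F' s) (at s)" if "0 < s" for s
    unfolding F_def F'_def using f[OF that] assms
    by (auto intro!: derivative_eq_intros simp: divide_simps)
  have dom: "exp (- (\<zeta> - s * v)\<^sup>2 / (8 * s)) / s \<le> F' s" if "0 < s" for s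
  proof -
    have u: "(f s)\<^sup>2 = (\<zeta> - s * v)\<^sup>2 / s"
      unfolding f_def using that by (simp add: power_divide)
    have "exp (- ((f s)\<^sup>2 / 8)) \<le> 8 / (1 + (f s)\<^sup>2)"
      by (rule exp_minus_div_8_le) simp
    then have e: "exp (- (\<zeta> - s * v)\<^sup>2 / (8 * s)) \<le> 8 / (1 + (f s)\<^sup>2)"
      unfolding u by (simp add: mult.commute)
    have "sqrt (\<zeta> * v) * sqrt s = sqrt (\<zeta> * (s * v))"
      by (simp add: real_sqrt_mult)
    also have "\<dots> \<le> (\<zeta> + s * v) / 2"
      using assms that by (intro arith_geo_mean_sqrt) auto
    finally have "sqrt (\<zeta> * v) * sqrt s \<le> (\<zeta> + s * v) / 2" .
    then have "1 / s \<le> - f' s / sqrt (\<zeta> * v)"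
      unfolding f'_def using assms that by (simp add: field_simps)
    with e have "exp (- (\<zeta> - s * v)\<^sup>2 / (8 * s)) * (1 / s) \<le> 8 / (1 + (f s)\<^sup>2) * (- f' s / sqrt (\<zeta> * v))"
      using that by (intro mult_mono) auto
    then show ?thesis unfolding F'_def by simp
  qed
  have "(\<integral>\<^sup>+s\<in>{a..t}. ennreal (exp (- (\<zeta> - s * v)\<^sup>2 / (8 * s)) / s) \<partial>lborel) \<le> ennreal (F t - F a)"
    using assms F dom by (intro nn_integral_Icc_le_antiderivative[where F' = F']) auto
  also have "F t - F a \<le> 26 / sqrt (\<zeta> * v)"
  proof -
    \<comment> \<open>The total variation of \<open>arctan\<close> is at most \<open>pi\<close>, so
      the constant is \<open>8 * pi\<close>, rounded up to \<open>8 * (13 / 4) = 26\<close>.\<close>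
    have pi_le: "pi \<le> 13 / 4"
      using pi_approx by simp
    have "arctan (f a) - arctan (f t) \<le> pi"
      using arctan_bounded[of "f a"] arctan_bounded[of "f t"] by linarith
    with pi_le have "arctan (f a) - arctan (f t) \<le> 13 / 4"
      by (rule order_trans[rotated])
    then have "8 * (arctan (f a) - arctan (f t)) \<le> 8 * (13 / 4)"
      by (rule mult_left_mono) simp
    then have "8 * (arctan (f a) - arctan (f t)) \<le> 26"
      by simp
    then have "8 * (arctan (f a) - arctan (f t)) / sqrt (\<zeta> * v) \<le> 26 / sqrt (\<zeta> * v)"
      using assms by (intro divide_right_mono) auto
    then show ?thesis unfolding F_def by (simp add: diff_divide_distrib algebra_simps)
  qed
  finally show ?thesis by (simp add: ennreal_leI)
qed

text \<open>On this range \<open>1 / s\<close> is at most the square of \<open>v\<close>, which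
  turns the integrand into an exact derivative. It serves the case where \<zeta> is at most
  \<open>1 / v\<close>.\<close>

lemma nn_integral_near_kernel_le:
  fixes v t :: real
  assumes "0 < v" "1 / v\<^sup>2 \<le> t"
  shows "(\<integral>\<^sup>+s\<in>{1 / v\<^sup>2..t}. ennreal (exp (- s * v\<^sup>2 / 4) / s) \<partial>lborel) \<le> 4"
proof -
  have "(\<integral>\<^sup>+s\<in>{1 / v\<^sup>2..t}. ennreal (exp (- s * v\<^sup>2 / 4) / s) \<partial>lborel)
      \<le> ennreal (- 4 * exp (- t * v\<^sup>2 / 4) - - 4 * exp (- (1 / v\<^sup>2) * v\<^sup>2 / 4))"
  proof (rule nn_integral_Icc_le_antiderivative[where F' = "\<lambda>s. v\<^sup>2 * exp (- s * v\<^sup>2 / 4)"])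
    fix s assume s: "s \<in> {1 / v\<^sup>2..t}"
    show "((\<lambda>s. - 4 * exp (- s * v\<^sup>2 / 4)) has_real_derivative v\<^sup>2 * exp (- s * v\<^sup>2 / 4)) (at s)"
      by (auto intro!: derivative_eq_intros)
    have "0 < 1 / v\<^sup>2" using assms by simp
    from less_le_trans[OF this] s have "0 < s" by auto
    moreover have "1 / s \<le> v\<^sup>2"
      using s assms \<open>0 < s\<close> by (simp add: field_simps)
    ultimately show "0 \<le> exp (- s * v\<^sup>2 / 4) / s \<and> exp (- s * v\<^sup>2 / 4) / s \<le> v\<^sup>2 * exp (- s * v\<^sup>2 / 4)"
      using mult_right_mono[of "1 / s" "v\<^sup>2" "exp (- s * v\<^sup>2 / 4)"] by simp
  qed (use assms in auto)
  also have "ennreal (- 4 * exp (- t * v\<^sup>2 / 4) - - 4 * exp (- (1 / v\<^sup>2) * v\<^sup>2 / 4)) \<le> ennreal 4"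
  proof (rule ennreal_leI)
    have "exp (- (1 / v\<^sup>2) * v\<^sup>2 / 4) \<le> 1"
      by simp
    with exp_ge_zero[of "- t * v\<^sup>2 / 4"]
    show "- 4 * exp (- t * v\<^sup>2 / 4) - - 4 * exp (- (1 / v\<^sup>2) * v\<^sup>2 / 4) \<le> 4"
      by linarith
  qed
  finally show ?thesis by simp
qed

lemma exp_half_le_2: "exp (1 / 2 :: real) \<le> 2"
  using exp_bound[of "1 / 2 :: real"] by (simp add: power2_eq_square)

lemma exp_minus_eighth_ge_half: "1 / 2 \<le> exp (- 1 / 8 :: real)"
  using exp_ge_add_one_self[of "- 1 / 8 :: real"] by simp

text \<open>The first two terms on the right absorb \<open>\<zeta> \<le> sqrt t\<close> and \<open>\<zeta> > t * v\<close>. In between, the left side is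
  \<open>O((\<zeta> v)\<^sup>-\<^sup>1\<^sup>/\<^sup>2)\<close>, and so is the part of the last integral where \<open>s * v\<close> lies within \<open>sqrt t\<close> below \<open>\<zeta>\<close>.\<close>

lemma drift_kernel_le:
  fixes \<zeta> v t :: real
  assumes "0 < t" "0 < v"
  shows "(\<integral>\<^sup>+s\<in>{1 / v\<^sup>2..t}. ennreal (exp (- (\<zeta> - s * v)\<^sup>2 / (4 * s)) / s) \<partial>lborel)
    \<le> 52 * (ennreal (exp (- \<zeta>\<^sup>2 / (8 * t))) + ennreal (exp (- (\<zeta> - t * v)\<^sup>2 / (8 * t)))
        + (\<integral>\<^sup>+s\<in>{0..t}. ennreal (1 / sqrt (s * t)) * ennreal (exp (- (\<zeta> - s * v)\<^sup>2 / (8 * t))) \<partial>lborel))"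
    (is "?K \<le> 52 * (?A + ?B + ?C)")
proof (cases "1 / v\<^sup>2 \<le> t")
  case False
  then show ?thesis by simp
next
  case True
  have spos: "0 < s" if "1 / v\<^sup>2 \<le> s" for s
    using that \<open>0 < v\<close> by (metis less_le_trans zero_less_divide_1_iff zero_less_power)
  have drift: "?K \<le> ennreal (26 / sqrt (\<zeta> * v))" if "0 < \<zeta>"
  proof -
    have "?K \<le> (\<integral>\<^sup>+s\<in>{1 / v\<^sup>2..t}. ennreal (exp (- (\<zeta> - s * v)\<^sup>2 / (8 * s)) / s) \<partial>lborel)"
    proof (intro nn_integral_mono)
      fix s
      show "ennreal (exp (- (\<zeta> - s * v)\<^sup>2 / (4 * s)) / s) * indicator {1 / v\<^sup>2..t} s
          \<le> ennreal (exp (- (\<zeta> - s * v)\<^sup>2 / (8 * s)) / s) * indicator {1 / v\<^sup>2..t} s"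
      proof (cases "s \<in> {1 / v\<^sup>2..t}")
        case True
        then have "0 < s" using spos by simp
        then have "- (\<zeta> - s * v)\<^sup>2 / (4 * s) \<le> - (\<zeta> - s * v)\<^sup>2 / (8 * s)"
          by (simp add: frac_le)
        with \<open>0 < s\<close> show ?thesis
          by (intro mult_right_mono ennreal_leI divide_right_mono) auto
      qed simp
    qed
    also have "\<dots> \<le> ennreal (26 / sqrt (\<zeta> * v))"
      using assms that True by (intro nn_integral_drift_kernel_le) auto
    finally show ?thesis .
  qed
  \<comment> \<open>Beyond the threshold \<open>1 / v\<close> the product \<open>\<zeta> * v\<close>
    exceeds 1, so the bound \<open>26 / sqrt (\<zeta> * v)\<close> is at most 26. Below it that
    bound is too weak and the square is expanded instead.\<close>
  consider "\<zeta> \<le> 1 / v" | "1 / v < \<zeta>" "\<zeta> \<le> sqrt t" | "1 / v < \<zeta>" "sqrt t < \<zeta>" "\<zeta> \<le> t * v"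
    | "1 / v < \<zeta>" "t * v < \<zeta>"
    by linarith
  then show ?thesis
  proof cases
    case 1
    have "?K \<le> (\<integral>\<^sup>+s. ennreal (2 * exp (- \<zeta>\<^sup>2 / (8 * t))) * (ennreal (exp (- s * v\<^sup>2 / 4) / s) * indicator {1 / v\<^sup>2..t} s) \<partial>lborel)"
    proof (intro nn_integral_mono)
      fix s
      have "ennreal (exp (- (\<zeta> - s * v)\<^sup>2 / (4 * s)) / s)
          \<le> ennreal (2 * exp (- \<zeta>\<^sup>2 / (8 * t))) * ennreal (exp (- s * v\<^sup>2 / 4) / s)" if s: "s \<in> {1 / v\<^sup>2..t}"
      proof -
        have "0 < s" using s spos by simp
        \<comment> \<open>The cross term of the expanded square contributes
          \<open>\<zeta> * v / 2\<close>, hence at most \<open>1 / 2\<close>, to the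
          exponent.\<close>
        have "\<zeta> * v \<le> 1" using 1 \<open>0 < v\<close> by (simp add: field_simps)
        then have "- (\<zeta> - s * v)\<^sup>2 / (4 * s) \<le> 1 / 2 + - \<zeta>\<^sup>2 / (4 * s) + - s * v\<^sup>2 / 4"
          using \<open>0 < s\<close> by (simp add: divide_simps power2_diff) (simp add: power2_eq_square algebra_simps)
        also have "- \<zeta>\<^sup>2 / (4 * s) \<le> - \<zeta>\<^sup>2 / (8 * t)"
          using s \<open>0 < s\<close> by (auto intro!: divide_left_mono)
        finally have "exp (- (\<zeta> - s * v)\<^sup>2 / (4 * s)) \<le> exp (1 / 2) * exp (- \<zeta>\<^sup>2 / (8 * t)) * exp (- s * v\<^sup>2 / 4)"
          by (simp add: exp_add[symmetric])
        also have "\<dots> \<le> 2 * exp (- \<zeta>\<^sup>2 / (8 * t)) * exp (- s * v\<^sup>2 / 4)"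
          using exp_half_le_2 by (intro mult_right_mono) auto
        finally have "exp (- (\<zeta> - s * v)\<^sup>2 / (4 * s)) / s \<le> (2 * exp (- \<zeta>\<^sup>2 / (8 * t))) * (exp (- s * v\<^sup>2 / 4) / s)"
          using \<open>0 < s\<close> by (simp add: divide_right_mono)
        then show ?thesis
          using \<open>0 < s\<close> by (subst ennreal_mult[symmetric]) (auto intro: ennreal_leI)
      qed
      then show "ennreal (exp (- (\<zeta> - s * v)\<^sup>2 / (4 * s)) / s) * indicator {1 / v\<^sup>2..t} s
          \<le> ennreal (2 * exp (- \<zeta>\<^sup>2 / (8 * t))) * (ennreal (exp (- s * v\<^sup>2 / 4) / s) * indicator {1 / v\<^sup>2..t} s)"
        by (auto split: split_indicator)
    qed
    also have "\<dots> \<le> ennreal (2 * exp (- \<zeta>\<^sup>2 / (8 * t))) * 4"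
      using nn_integral_near_kernel_le[OF \<open>0 < v\<close> True] by (subst nn_integral_cmult) (auto intro: mult_left_mono)
    also have "\<dots> = 8 * ?A"
      by (simp add: ennreal_mult' mult_ac)
    also have "\<dots> \<le> 52 * (?A + ?B + ?C)"
      by (intro mult_mono) (auto simp: add.assoc intro: add_increasing2)
    finally show ?thesis .
  next
    case 2
    then have "0 < \<zeta>" using \<open>0 < v\<close> by (meson less_trans zero_less_divide_1_iff)
    have "1 < \<zeta> * v" using 2(1) \<open>0 < v\<close> by (simp add: field_simps)
    then have "26 / sqrt (\<zeta> * v) \<le> 26"
      by (simp add: divide_le_eq)
    \<comment> \<open>Here the Gaussian in \<open>?A\<close> is at least \<open>1 / 2\<close>, so 26
      is absorbed by \<open>52 * ?A\<close>; this is the source of the constant 52.\<close>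
    moreover have "- 1 / 8 \<le> - \<zeta>\<^sup>2 / (8 * t)"
      using \<open>0 < t\<close> \<open>0 < \<zeta>\<close> 2(2) sqrt_ge_absD[of \<zeta> t] by (simp add: field_simps)
    then have "1 / 2 \<le> exp (- \<zeta>\<^sup>2 / (8 * t))"
      using exp_minus_eighth_ge_half by (meson exp_le_cancel_iff order_trans)
    ultimately have "26 / sqrt (\<zeta> * v) \<le> 52 * exp (- \<zeta>\<^sup>2 / (8 * t))"
      by simp
    then have "ennreal (26 / sqrt (\<zeta> * v)) \<le> 52 * ?A"
      unfolding ennreal_numeral_mult[symmetric] by (rule ennreal_leI)
    with drift[OF \<open>0 < \<zeta>\<close>] have "?K \<le> 52 * ?A"
      by (rule order_trans)
    also have "\<dots> \<le> 52 * (?A + ?B + ?C)"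
      by (intro mult_mono) (auto simp: add.assoc intro: add_increasing2)
    finally show ?thesis .
  next
    case 3
    then have "0 < \<zeta>" using \<open>0 < v\<close> by (meson less_trans zero_less_divide_1_iff)
    \<comment> \<open>On the window \<open>{lo..hi}\<close> the distance
      \<open>\<zeta> - s * v\<close> runs through \<open>{0..sqrt t}\<close>, so the Gaussian in
      \<open>?C\<close> is at least \<open>1 / 2\<close> and the density at least
      \<open>1 / sqrt (hi * t)\<close>. Multiplying by the window length \<open>sqrt t / v\<close>
      gives exactly \<open>1 / (2 * sqrt (\<zeta> * v))\<close>.\<close>
    define lo hi where "lo = (\<zeta> - sqrt t) / v" and "hi = \<zeta> / v"
    have lohi: "0 < lo" "lo \<le> hi" "hi \<le> t" "hi - lo = sqrt t / v"
      using 3 \<open>0 < v\<close> \<open>0 < t\<close> by (auto simp: lo_def hi_def field_simps)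
    have "ennreal (1 / (2 * sqrt (\<zeta> * v))) = ennreal (1 / sqrt (hi * t) * (1 / 2)) * ennreal (hi - lo)"
    proof -
      have "1 / (2 * sqrt (\<zeta> * v)) = 1 / sqrt (hi * t) * (1 / 2) * (hi - lo)"
        unfolding lohi(4) using assms \<open>0 < \<zeta>\<close>
        by (simp add: hi_def real_sqrt_mult real_sqrt_divide real_div_sqrt field_simps)
      then show ?thesis
        using lohi assms by (simp add: ennreal_mult[symmetric])
    qed
    also have "\<dots> = (\<integral>\<^sup>+s\<in>{lo..hi}. ennreal (1 / sqrt (hi * t) * (1 / 2)) \<partial>lborel)"
      using lohi by (simp add: nn_integral_cmult)
    also have "\<dots> \<le> ?C"
    proof (intro nn_integral_mono)
      fix s
      have "ennreal (1 / sqrt (hi * t) * (1 / 2)) \<le> ennreal (1 / sqrt (s * t)) * ennreal (exp (- (\<zeta> - s * v)\<^sup>2 / (8 * t)))"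
        if s: "s \<in> {lo..hi}"
      proof -
        have "0 < s" using s lohi by simp
        have "1 / sqrt (hi * t) \<le> 1 / sqrt (s * t)"
          using s \<open>0 < s\<close> \<open>0 < t\<close> by (intro divide_left_mono) (auto intro!: mult_pos_pos)
        moreover have "0 \<le> \<zeta> - s * v" "\<zeta> - s * v \<le> sqrt t"
          using s \<open>0 < v\<close> by (auto simp: lo_def hi_def field_simps)
        then have "(\<zeta> - s * v)\<^sup>2 \<le> t"
          using \<open>0 < t\<close> by (metis power_mono real_sqrt_pow2 less_imp_le)
        then have "- 1 / 8 \<le> - (\<zeta> - s * v)\<^sup>2 / (8 * t)"
          using \<open>0 < t\<close> by (simp add: field_simps)
        then have "1 / 2 \<le> exp (- (\<zeta> - s * v)\<^sup>2 / (8 * t))"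
          using exp_minus_eighth_ge_half by (meson exp_le_cancel_iff order_trans)
        ultimately have "1 / sqrt (hi * t) * (1 / 2) \<le> 1 / sqrt (s * t) * exp (- (\<zeta> - s * v)\<^sup>2 / (8 * t))"
          using \<open>0 < s\<close> \<open>0 < t\<close> by (intro mult_mono) auto
        then show ?thesis
          using \<open>0 < s\<close> \<open>0 < t\<close> by (subst ennreal_mult[symmetric]) (auto intro: ennreal_leI)
      qed
      then show "ennreal (1 / sqrt (hi * t) * (1 / 2)) * indicator {lo..hi} s
          \<le> ennreal (1 / sqrt (s * t)) * ennreal (exp (- (\<zeta> - s * v)\<^sup>2 / (8 * t))) * indicator {0..t} s"
        using lohi by (auto split: split_indicator)
    qed
    finally have "52 * ennreal (1 / (2 * sqrt (\<zeta> * v))) \<le> 52 * ?C"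
      by (rule mult_left_mono) simp
    moreover have "52 * ennreal (1 / (2 * sqrt (\<zeta> * v))) = ennreal (26 / sqrt (\<zeta> * v))"
    proof -
      have "26 / sqrt (\<zeta> * v) = 52 * (1 / (2 * sqrt (\<zeta> * v)))" by simp
      then show ?thesis by (simp only: ennreal_numeral_mult)
    qed
    ultimately have "?K \<le> 52 * ?C"
      using drift[OF \<open>0 < \<zeta>\<close>] by simp
    also have "\<dots> \<le> 52 * (?A + ?B + ?C)"
      by (intro mult_left_mono) (auto intro: add_increasing)
    finally show ?thesis .
  next
    case 4
    then have "0 < \<zeta>" using \<open>0 < v\<close> by (meson less_trans zero_less_divide_1_iff)
    \<comment> \<open>The exponent is split into two equal halves. As \<zeta> lies beyond
      \<open>t * v\<close>, the quotient of the square of \<open>\<zeta> - s * v\<close> by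
      \<open>8 * s\<close> is smallest at \<open>s = t\<close>, so one half is dominated by
      \<open>?B\<close>; the other half is kept for the arctangent bound.\<close>
    have "?K \<le> (\<integral>\<^sup>+s. ?B * (ennreal (exp (- (\<zeta> - s * v)\<^sup>2 / (8 * s)) / s) * indicator {1 / v\<^sup>2..t} s) \<partial>lborel)"
    proof (intro nn_integral_mono)
      fix s
      have "ennreal (exp (- (\<zeta> - s * v)\<^sup>2 / (4 * s)) / s) \<le> ?B * ennreal (exp (- (\<zeta> - s * v)\<^sup>2 / (8 * s)) / s)"
        if s: "s \<in> {1 / v\<^sup>2..t}"
      proof -
        have "0 < s" using s spos by simp
        have "s * v \<le> t * v" using s \<open>0 < v\<close> by simp
        then have "(\<zeta> - t * v)\<^sup>2 \<le> (\<zeta> - s * v)\<^sup>2"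
          using 4(2) by (intro power_mono) auto
        then have "(\<zeta> - t * v)\<^sup>2 / (8 * t) \<le> (\<zeta> - s * v)\<^sup>2 / (8 * s)"
          using s \<open>0 < s\<close> by (intro frac_le) auto
        then have "- (\<zeta> - s * v)\<^sup>2 / (4 * s) \<le> - (\<zeta> - t * v)\<^sup>2 / (8 * t) + - (\<zeta> - s * v)\<^sup>2 / (8 * s)"
          using \<open>0 < s\<close> by (simp add: field_simps)
        then have "exp (- (\<zeta> - s * v)\<^sup>2 / (4 * s)) \<le> exp (- (\<zeta> - t * v)\<^sup>2 / (8 * t)) * exp (- (\<zeta> - s * v)\<^sup>2 / (8 * s))"
          by (simp add: exp_add[symmetric])
        then have "exp (- (\<zeta> - s * v)\<^sup>2 / (4 * s)) / s \<le> exp (- (\<zeta> - t * v)\<^sup>2 / (8 * t)) * (exp (- (\<zeta> - s * v)\<^sup>2 / (8 * s)) / s)"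
          using \<open>0 < s\<close> by (simp add: divide_right_mono)
        then show ?thesis
          using \<open>0 < s\<close> by (subst ennreal_mult[symmetric]) (auto intro: ennreal_leI)
      qed
      then show "ennreal (exp (- (\<zeta> - s * v)\<^sup>2 / (4 * s)) / s) * indicator {1 / v\<^sup>2..t} s
          \<le> ?B * (ennreal (exp (- (\<zeta> - s * v)\<^sup>2 / (8 * s)) / s) * indicator {1 / v\<^sup>2..t} s)"
        by (auto split: split_indicator)
    qed
    also have "\<dots> \<le> ?B * ennreal (26 / sqrt (\<zeta> * v))"
      using nn_integral_drift_kernel_le[OF \<open>0 < \<zeta>\<close> \<open>0 < v\<close> spos[OF order.refl] True]
      by (subst nn_integral_cmult) (auto intro: mult_left_mono)
    also have "\<dots> \<le> ?B * 52"
    proof -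
      have "1 < \<zeta> * v" using 4(1) \<open>0 < v\<close> by (simp add: field_simps)
      then have "26 / sqrt (\<zeta> * v) \<le> 26"
        by (simp add: divide_le_eq)
      then have "26 / sqrt (\<zeta> * v) \<le> 52"
        by simp
      then have "ennreal (26 / sqrt (\<zeta> * v)) \<le> ennreal 52"
        by (rule ennreal_leI)
      then show ?thesis
        by (intro mult_left_mono) simp_all
    qed
    also have "\<dots> \<le> 52 * (?A + ?B + ?C)"
      unfolding mult.commute[of _ "52 :: ennreal"]
      by (intro mult_left_mono) (auto intro: add_increasing add_increasing2)
    finally show ?thesis .
  qed
qed

section \<open>From the scalar kernel to potentials with drift\<close>

lemma exp_eq_heat_g:
  fixes x z :: "'a::euclidean_space"
  assumes "0 < t" "DIM('a) = 2"
  shows "exp (- (norm (z - x))\<^sup>2 / (8 * t)) = 8 * pi * t * heat_g (2 * t) x z"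
  using assms by (simp add: heat_g_def powr_minus divide_simps)

text \<open>Pythagoras: the drift moves only the component of \<open>u\<close> along
  \<open>w\<close>, and the orthogonal part is independent of \<open>s\<close>.\<close>

lemma norm_drift_sq:
  fixes u w :: "'a::real_inner"
  assumes "w \<noteq> 0"
  shows "(norm (u - s *\<^sub>R w))\<^sup>2 = (u \<bullet> w / norm w - s * norm w)\<^sup>2 + ((norm u)\<^sup>2 - (u \<bullet> w / norm w)\<^sup>2)"
  using assms
  by (simp add: power2_norm_eq_inner inner_diff_left inner_diff_right inner_commute power2_diff power_mult_distrib)
     (simp add: power2_eq_square norm_eq_sqrt_inner)

lemma pot_mult_le:
  fixes V :: "'a::euclidean_space \<Rightarrow> real"
  assumes [measurable]: "V \<in> borel_measurable borel"
    and "0 \<le> c" "\<And>z. heat_g s x z \<le> c * heat_g r y z"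
  shows "pot V s x \<le> ennreal c * pot V r y"
proof -
  have "pot V s x \<le> (\<integral>\<^sup>+z. ennreal c * ennreal (heat_g r y z * \<bar>V z\<bar>) \<partial>lborel)"
    unfolding pot_def
  proof (intro nn_integral_mono)
    fix z
    have "heat_g s x z * \<bar>V z\<bar> \<le> c * (heat_g r y z * \<bar>V z\<bar>)"
      using mult_right_mono[OF assms(3)[of z], of "\<bar>V z\<bar>"] by simp
    then show "ennreal (heat_g s x z * \<bar>V z\<bar>) \<le> ennreal c * ennreal (heat_g r y z * \<bar>V z\<bar>)"
      using \<open>0 \<le> c\<close> by (simp only: ennreal_mult'[symmetric] ennreal_leI)
  qed
  then show ?thesis
    by (simp add: pot_def nn_integral_cmult)
qed

text \<open>The estimate for \<open>pot V s y\<close> is uniform in the centre \<open>y\<close>,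
  hence insensitive to the drift. The constant is 2 (dilation to time \<open>2 * t\<close>) times 4
  (\<open>pot_le_heat_pot\<close>) times 2 (time integral).\<close>

lemma nn_integral_pot_drift_le_dim1:
  fixes V :: "'a::euclidean_space \<Rightarrow> real"
  assumes [measurable]: "V \<in> borel_measurable borel" and "0 < t" "DIM('a) = 1"
  shows "(\<integral>\<^sup>+s\<in>{0..t}. pot V s (x + s *\<^sub>R w) \<partial>lborel) \<le> 16 * heat_pot V t"
proof -
  have bound: "pot V s y \<le> ennreal (1 / sqrt (s * t)) * (8 * heat_pot V t)" if "0 < s" "s \<le> t" for s y
  proof -
    have "heat_g s y z \<le> 2 * t / sqrt (s * t) * heat_g (2 * t) y z" for z
    proof -
      have "exp (- (norm (z - y))\<^sup>2 / (4 * s)) \<le> exp (- (norm (z - y))\<^sup>2 / (4 * (2 * t)))"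
        using that by (auto simp: frac_le)
      moreover have "(4 * pi * s) powr (- (real DIM('a) / 2)) \<le> 2 * t / sqrt (s * t) * (4 * pi * (2 * t)) powr (- (real DIM('a) / 2))"
      proof -
        have sqrt8: "sqrt 8 = 2 * sqrt 2"
          using real_sqrt_mult[of 4 2] by simp
        have "sqrt 2 \<le> 2"
          using real_le_lsqrt[of 2 2] by simp
        have "sqrt t * (sqrt 2 * sqrt t) = sqrt 2 * (sqrt t * sqrt t)"
          by (rule mult.left_commute)
        also have "\<dots> = sqrt 2 * t"
          using \<open>0 < t\<close> by simp
        also have "\<dots> \<le> 2 * t"
          using \<open>0 < t\<close> \<open>sqrt 2 \<le> 2\<close> by (intro mult_right_mono) auto
        finally have le_2t: "sqrt t * (sqrt 2 * sqrt t) \<le> 2 * t" .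
        have "1 / sqrt s \<le> 2 * t / (sqrt s * sqrt t) / (sqrt 2 * sqrt t)"
          using that \<open>0 < t\<close> le_2t by (simp add: divide_simps)
        then have "1 / sqrt s / sqrt (4 * pi) \<le> 2 * t / (sqrt s * sqrt t) / (sqrt 2 * sqrt t) / sqrt (4 * pi)"
          by (rule divide_right_mono) simp
        then show ?thesis
          using that \<open>0 < t\<close> assms(3)
          by (simp add: powr_minus_divide powr_half_sqrt real_sqrt_mult mult_ac sqrt8)
      qed
      ultimately show ?thesis
        unfolding heat_g_def mult.assoc[symmetric] using that \<open>0 < t\<close> by (intro mult_mono) auto
    qed
    then have "pot V s y \<le> ennreal (2 * t / sqrt (s * t)) * pot V (2 * t) y"
      using that by (intro pot_mult_le) auto
    also have "\<dots> \<le> ennreal (2 * t / sqrt (s * t)) * (ennreal (4 / t) * heat_pot V t)"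
      using assms by (intro mult_left_mono pot_le_heat_pot) auto
    also have "\<dots> = ennreal (2 * t / sqrt (s * t) * (4 / t)) * heat_pot V t"
      using that \<open>0 < t\<close> by (subst ennreal_mult) (auto simp: mult.assoc)
    also have "2 * t / sqrt (s * t) * (4 / t) = 8 * (1 / sqrt (s * t))"
      using \<open>0 < t\<close> by simp
    finally show ?thesis
      by (simp only: ennreal_numeral_mult mult_ac)
  qed
  have "(\<integral>\<^sup>+s\<in>{0..t}. pot V s (x + s *\<^sub>R w) \<partial>lborel)
      \<le> (\<integral>\<^sup>+s. (ennreal (1 / sqrt (s * t)) * indicator {0..t} s) * (8 * heat_pot V t) \<partial>lborel)"
  proof (intro nn_integral_mono)
    fix s
    show "pot V s (x + s *\<^sub>R w) * indicator {0..t} s \<le> (ennreal (1 / sqrt (s * t)) * indicator {0..t} s) * (8 * heat_pot V t)"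
    proof (cases "0 < s \<and> s \<le> t")
      case True
      then show ?thesis using bound[of s "x + s *\<^sub>R w"] by simp
    next
      case False
      \<comment> \<open>The singular time needs separate care: \<open>heat_g 0\<close> is 0 because
        \<open>0 powr _ = 0\<close>.\<close>
      have "pot V 0 x = 0" by (simp add: pot_def heat_g_def)
      with False show ?thesis by (cases "s = 0") auto
    qed
  qed
  also have "\<dots> = 2 * (8 * heat_pot V t)"
    using nn_integral_inverse_sqrt[OF \<open>0 < t\<close>] by (simp add: nn_integral_multc)
  finally show ?thesis by (simp add: mult.assoc[symmetric])
qed

text \<open>For these \<open>s\<close> the centre has moved by at most \<open>sqrt s\<close>, which
  doubling the time absorbs: a factor 2 from the prefactor and \<open>exp (1 / 2)\<close>, at most
  2, from the shift. The substitution of \<open>2 * s\<close> then halves the factor 4 and stretches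
  \<open>{0..t / 2}\<close> to \<open>{0..t}\<close>.\<close>

lemma nn_integral_pot_drift_le_near:
  fixes V :: "'a::euclidean_space \<Rightarrow> real"
  assumes [measurable]: "V \<in> borel_measurable borel" and "0 < t" "DIM('a) = 2"
  shows "(\<integral>\<^sup>+s\<in>{0..t / 2} \<inter> {s. s * (norm w)\<^sup>2 \<le> 1}. pot V s (x + s *\<^sub>R w) \<partial>lborel) \<le> 2 * heat_pot V t"
proof -
  have bound: "pot V s (x + s *\<^sub>R w) \<le> 4 * pot V (2 * s) x" if "0 < s" "s * (norm w)\<^sup>2 \<le> 1" for s
  proof -
    have "heat_g s (x + s *\<^sub>R w) z \<le> 4 * heat_g (2 * s) x z" for z
    proof -
      define n where "n = norm (z - (x + s *\<^sub>R w))"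
      define m where "m = norm (z - x)"
      define k where "k = s * norm w"
      have "z - x = (z - (x + s *\<^sub>R w)) + s *\<^sub>R w" by simp
      then have "m \<le> n + k"
        unfolding m_def n_def k_def using norm_triangle_ineq[of "z - (x + s *\<^sub>R w)" "s *\<^sub>R w"] that by simp
      then have "m\<^sup>2 \<le> (n + k)\<^sup>2"
        by (intro power_mono) (auto simp: m_def)
      also have "\<dots> \<le> 2 * n\<^sup>2 + 2 * k\<^sup>2"
        using zero_le_power2[of "n - k"] by (simp add: power2_sum power2_diff)
      also have "k\<^sup>2 = s * (s * (norm w)\<^sup>2)"
        by (simp add: k_def power2_eq_square)
      also have "\<dots> \<le> s * 1"
        using that by (intro mult_left_mono) auto
      finally have "- n\<^sup>2 / (4 * s) \<le> 1 / 2 + - m\<^sup>2 / (4 * (2 * s))"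
        using that by (simp add: field_simps)
      then have "exp (- n\<^sup>2 / (4 * s)) \<le> exp (1 / 2) * exp (- m\<^sup>2 / (4 * (2 * s)))"
        by (simp add: exp_add[symmetric])
      also have "\<dots> \<le> 2 * exp (- m\<^sup>2 / (4 * (2 * s)))"
        using exp_half_le_2 by (intro mult_right_mono) auto
      finally show ?thesis
        using that assms(3) by (simp add: heat_g_def n_def m_def powr_minus divide_simps)
    qed
    from pot_mult_le[OF assms(1) _ this] show ?thesis
      by simp
  qed
  have "(\<integral>\<^sup>+s\<in>{0..t / 2} \<inter> {s. s * (norm w)\<^sup>2 \<le> 1}. pot V s (x + s *\<^sub>R w) \<partial>lborel)
      \<le> (\<integral>\<^sup>+s. 4 * (pot V (2 * s) x * indicator {0..t} (2 * s)) \<partial>lborel)"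
  proof (intro nn_integral_mono)
    fix s
    show "pot V s (x + s *\<^sub>R w) * indicator ({0..t / 2} \<inter> {s. s * (norm w)\<^sup>2 \<le> 1}) s
        \<le> 4 * (pot V (2 * s) x * indicator {0..t} (2 * s))"
    proof (cases "0 < s \<and> s \<le> t / 2 \<and> s * (norm w)\<^sup>2 \<le> 1")
      case True
      then show ?thesis using bound[of s] by simp
    next
      case False
      have "pot V 0 x = 0" using assms(3) by (simp add: pot_def heat_g_def)
      with False show ?thesis by (cases "s = 0") (auto split: split_indicator)
    qed
  qed
  also have "\<dots> = 4 * (\<integral>\<^sup>+s. pot V (2 * s) x * indicator {0..t} (2 * s) \<partial>lborel)"
    by (intro nn_integral_cmult) measurable
  also have "\<dots> = 2 * (2 * (\<integral>\<^sup>+s. pot V (2 * s) x * indicator {0..t} (2 * s) \<partial>lborel))"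
    by (simp add: mult.assoc[symmetric])
  also have "2 * (\<integral>\<^sup>+s. pot V (2 * s) x * indicator {0..t} (2 * s) \<partial>lborel) = (\<integral>\<^sup>+s\<in>{0..t}. pot V s x \<partial>lborel)"
    using nn_integral_real_affine[of "\<lambda>s. pot V s x * indicator {0..t} s" 2 0] by simp
  also have "2 * \<dots> \<le> 2 * heat_pot V t"
    by (intro mult_left_mono pot_integral_le_heat_pot) simp
  finally show ?thesis .
qed

text \<open>The kernel factors into an orthogonal Gaussian and the scalar drift kernel in the
  coordinate \<zeta> along \<open>w\<close>. After \<open>drift_kernel_le\<close>, each scalar
  Gaussian of scale \<open>8 * t\<close> recombines with the orthogonal factor \<open>E\<close> into
  a kernel at time \<open>2 * t\<close>.\<close>

lemma nn_integral_heat_g_drift_le: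
  fixes x z w :: "'a::euclidean_space"
  assumes "0 < t" "DIM('a) = 2" "w \<noteq> 0"
  shows "(\<integral>\<^sup>+s\<in>{1 / (norm w)\<^sup>2..t}. ennreal (heat_g s (x + s *\<^sub>R w) z) \<partial>lborel)
    \<le> ennreal (104 * t) * (ennreal (heat_g (2 * t) x z) + ennreal (heat_g (2 * t) (x + t *\<^sub>R w) z)
        + (\<integral>\<^sup>+s\<in>{0..t}. ennreal (1 / sqrt (s * t)) * ennreal (heat_g (2 * t) (x + s *\<^sub>R w) z) \<partial>lborel))"
proof -
  define v where "v = norm w"
  define u where "u = z - x"
  define \<zeta> where "\<zeta> = u \<bullet> w / v"
  define \<eta> where "\<eta> = (norm u)\<^sup>2 - \<zeta>\<^sup>2"
  have "0 < v" using assms by (simp add: v_def)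
  have drift: "(norm (z - (x + s *\<^sub>R w)))\<^sup>2 = (\<zeta> - s * v)\<^sup>2 + \<eta>" for s
    using norm_drift_sq[OF \<open>w \<noteq> 0\<close>, of u s] by (simp add: u_def \<zeta>_def \<eta>_def v_def diff_diff_eq)
  \<comment> \<open>At \<open>s = \<zeta> / v\<close> the parallel component vanishes, so \<eta>
    equals a squared norm.\<close>
  have "0 \<le> \<eta>"
    using drift[of "\<zeta> / v"] \<open>0 < v\<close> zero_le_power2[of "norm (z - (x + (\<zeta> / v) *\<^sub>R w))"] by simp
  define E where "E = exp (- \<eta> / (8 * t))"
  have split: "ennreal E * ennreal (exp (- (\<zeta> - s * v)\<^sup>2 / (8 * t))) = ennreal (8 * pi * t) * ennreal (heat_g (2 * t) (x + s *\<^sub>R w) z)" for s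
  proof -
    have "- \<eta> / (8 * t) + - (\<zeta> - s * v)\<^sup>2 / (8 * t) = - ((\<zeta> - s * v)\<^sup>2 + \<eta>) / (8 * t)"
      by (simp add: add_divide_distrib diff_divide_distrib)
    then have "E * exp (- (\<zeta> - s * v)\<^sup>2 / (8 * t)) = 8 * pi * t * heat_g (2 * t) (x + s *\<^sub>R w) z"
      by (simp only: exp_eq_heat_g[OF assms(1,2), symmetric] drift E_def exp_add[symmetric])
    then show ?thesis
      using \<open>0 < t\<close> by (simp add: ennreal_mult[symmetric] E_def)
  qed
  have "(\<integral>\<^sup>+s\<in>{1 / (norm w)\<^sup>2..t}. ennreal (heat_g s (x + s *\<^sub>R w) z) \<partial>lborel)
      \<le> (\<integral>\<^sup>+s. ennreal (E / (4 * pi)) * (ennreal (exp (- (\<zeta> - s * v)\<^sup>2 / (4 * s)) / s) * indicator {1 / v\<^sup>2..t} s) \<partial>lborel)"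
  proof (intro nn_integral_mono)
    fix s
    have "ennreal (heat_g s (x + s *\<^sub>R w) z) \<le> ennreal (E / (4 * pi)) * ennreal (exp (- (\<zeta> - s * v)\<^sup>2 / (4 * s)) / s)"
      if s: "s \<in> {1 / v\<^sup>2..t}"
    proof -
      have "0 < 1 / v\<^sup>2" using \<open>0 < v\<close> by simp
      from less_le_trans[OF this] s have "0 < s" by auto
      have "\<eta> / (8 * t) \<le> \<eta> / (4 * s)"
        using s \<open>0 < s\<close> \<open>0 \<le> \<eta>\<close> by (intro frac_le) auto
      then have "- ((\<zeta> - s * v)\<^sup>2 + \<eta>) / (4 * s) \<le> - \<eta> / (8 * t) + - (\<zeta> - s * v)\<^sup>2 / (4 * s)"
        by (simp add: add_divide_distrib diff_divide_distrib)
      then have "exp (- ((\<zeta> - s * v)\<^sup>2 + \<eta>) / (4 * s)) \<le> E * exp (- (\<zeta> - s * v)\<^sup>2 / (4 * s))"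
        by (simp only: E_def exp_add[symmetric] exp_le_cancel_iff)
      then have "exp (- ((\<zeta> - s * v)\<^sup>2 + \<eta>) / (4 * s)) / (4 * pi * s) \<le> E * exp (- (\<zeta> - s * v)\<^sup>2 / (4 * s)) / (4 * pi * s)"
        using \<open>0 < s\<close> by (intro divide_right_mono) auto
      then have "heat_g s (x + s *\<^sub>R w) z \<le> E / (4 * pi) * (exp (- (\<zeta> - s * v)\<^sup>2 / (4 * s)) / s)"
        using \<open>0 < s\<close> assms(2) unfolding heat_g_def drift by (simp add: powr_minus_divide)
      moreover have "ennreal (E / (4 * pi)) * ennreal (exp (- (\<zeta> - s * v)\<^sup>2 / (4 * s)) / s) = ennreal (E / (4 * pi) * (exp (- (\<zeta> - s * v)\<^sup>2 / (4 * s)) / s))"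
        using \<open>0 < s\<close> by (intro ennreal_mult[symmetric]) (auto simp: E_def)
      ultimately show ?thesis
        by (simp only: ennreal_leI)
    qed
    then show "ennreal (heat_g s (x + s *\<^sub>R w) z) * indicator {1 / (norm w)\<^sup>2..t} s
        \<le> ennreal (E / (4 * pi)) * (ennreal (exp (- (\<zeta> - s * v)\<^sup>2 / (4 * s)) / s) * indicator {1 / v\<^sup>2..t} s)"
      by (auto split: split_indicator simp: v_def)
  qed
  also have "\<dots> = ennreal (E / (4 * pi)) * (\<integral>\<^sup>+s\<in>{1 / v\<^sup>2..t}. ennreal (exp (- (\<zeta> - s * v)\<^sup>2 / (4 * s)) / s) \<partial>lborel)"
    by (intro nn_integral_cmult) measurable
  also have "\<dots> \<le> ennreal (E / (4 * pi)) * (52 * (ennreal (exp (- \<zeta>\<^sup>2 / (8 * t))) + ennreal (exp (- (\<zeta> - t * v)\<^sup>2 / (8 * t)))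
        + (\<integral>\<^sup>+s\<in>{0..t}. ennreal (1 / sqrt (s * t)) * ennreal (exp (- (\<zeta> - s * v)\<^sup>2 / (8 * t))) \<partial>lborel)))"
    using \<open>0 < v\<close> \<open>0 < t\<close> by (intro mult_left_mono drift_kernel_le) auto
  \<comment> \<open>The factor is \<open>52 / (4 * pi) = 13 / pi\<close>. Writing
    \<open>0 * v\<close> gives all three Gaussians the shape of \<open>split\<close>, whose factor
    \<open>8 * pi * t\<close> then produces \<open>104 * t\<close>.\<close>
  also have "\<dots> = ennreal (13 / pi) * (ennreal E * ennreal (exp (- (\<zeta> - 0 * v)\<^sup>2 / (8 * t))) + ennreal E * ennreal (exp (- (\<zeta> - t * v)\<^sup>2 / (8 * t)))
        + (\<integral>\<^sup>+s\<in>{0..t}. ennreal (1 / sqrt (s * t)) * (ennreal E * ennreal (exp (- (\<zeta> - s * v)\<^sup>2 / (8 * t)))) \<partial>lborel))"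
  proof -
    have "ennreal (E / (4 * pi)) * 52 = ennreal (13 / pi) * ennreal E"
    proof -
      have "ennreal (E / (4 * pi)) * 52 = ennreal (52 * (E / (4 * pi)))"
        by (simp only: ennreal_numeral_mult mult.commute)
      also have "52 * (E / (4 * pi)) = 13 / pi * E" by simp
      also have "ennreal (13 / pi * E) = ennreal (13 / pi) * ennreal E"
        by (rule ennreal_mult) (auto simp: E_def)
      finally show ?thesis .
    qed
    moreover have "(\<integral>\<^sup>+s\<in>{0..t}. ennreal (1 / sqrt (s * t)) * (ennreal E * ennreal (exp (- (\<zeta> - s * v)\<^sup>2 / (8 * t)))) \<partial>lborel)
        = ennreal E * (\<integral>\<^sup>+s\<in>{0..t}. ennreal (1 / sqrt (s * t)) * ennreal (exp (- (\<zeta> - s * v)\<^sup>2 / (8 * t))) \<partial>lborel)"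
      by (subst nn_integral_cmult[symmetric]) (simp_all add: mult_ac)
    ultimately show ?thesis
      by (simp only: mult.assoc[symmetric]) (simp add: algebra_simps)
  qed
  also have "\<dots> = ennreal (13 / pi) * (ennreal (8 * pi * t) * (ennreal (heat_g (2 * t) x z) + ennreal (heat_g (2 * t) (x + t *\<^sub>R w) z)
        + (\<integral>\<^sup>+s\<in>{0..t}. ennreal (1 / sqrt (s * t)) * ennreal (heat_g (2 * t) (x + s *\<^sub>R w) z) \<partial>lborel)))"
  proof -
    have "(\<integral>\<^sup>+s\<in>{0..t}. ennreal (1 / sqrt (s * t)) * (ennreal (8 * pi * t) * ennreal (heat_g (2 * t) (x + s *\<^sub>R w) z)) \<partial>lborel)
        = ennreal (8 * pi * t) * (\<integral>\<^sup>+s\<in>{0..t}. ennreal (1 / sqrt (s * t)) * ennreal (heat_g (2 * t) (x + s *\<^sub>R w) z) \<partial>lborel)"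
      by (subst nn_integral_cmult[symmetric]) (simp_all add: mult_ac)
    then show ?thesis
      unfolding split by (simp add: distrib_left)
  qed
  also have "\<dots> = ennreal (104 * t) * (ennreal (heat_g (2 * t) x z) + ennreal (heat_g (2 * t) (x + t *\<^sub>R w) z)
        + (\<integral>\<^sup>+s\<in>{0..t}. ennreal (1 / sqrt (s * t)) * ennreal (heat_g (2 * t) (x + s *\<^sub>R w) z) \<partial>lborel))"
    using \<open>0 < t\<close> by (simp add: mult.assoc[symmetric] ennreal_mult[symmetric])
  finally show ?thesis .
qed

text \<open>By Tonelli the kernel bound becomes a superposition of values
  \<open>pot V (2 * t) a\<close>, each at most \<open>4 / t\<close> times
  \<open>heat_pot V t\<close>. The total mass is \<open>1 + 1 + 2 = 4\<close>, so the constant is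
  \<open>104 * 4 * 4 = 1664\<close>.\<close>

lemma nn_integral_pot_drift_le_far:
  fixes V :: "'a::euclidean_space \<Rightarrow> real"
  assumes [measurable]: "V \<in> borel_measurable borel" and "0 < t" "DIM('a) = 2" "w \<noteq> 0"
  shows "(\<integral>\<^sup>+s\<in>{1 / (norm w)\<^sup>2..t}. pot V s (x + s *\<^sub>R w) \<partial>lborel) \<le> 1664 * heat_pot V t"
proof -
  define M where "M = ennreal (4 / t) * heat_pot V t"
  have M: "pot V (2 * t) y \<le> M" for y
    unfolding M_def using assms by (intro pot_le_heat_pot) auto
  have "(\<integral>\<^sup>+s\<in>{1 / (norm w)\<^sup>2..t}. pot V s (x + s *\<^sub>R w) \<partial>lborel)
      = (\<integral>\<^sup>+s. \<integral>\<^sup>+z. ennreal (heat_g s (x + s *\<^sub>R w) z) * ennreal \<bar>V z\<bar> * indicator {1 / (norm w)\<^sup>2..t} s \<partial>lborel \<partial>lborel)"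
    unfolding pot_def by (simp add: nn_integral_multc ennreal_mult)
  also have "\<dots> = (\<integral>\<^sup>+z. \<integral>\<^sup>+s. ennreal (heat_g s (x + s *\<^sub>R w) z) * ennreal \<bar>V z\<bar> * indicator {1 / (norm w)\<^sup>2..t} s \<partial>lborel \<partial>lborel)"
    by (rule lborel_pair.Fubini') measurable
  also have "\<dots> = (\<integral>\<^sup>+z. (\<integral>\<^sup>+s\<in>{1 / (norm w)\<^sup>2..t}. ennreal (heat_g s (x + s *\<^sub>R w) z) \<partial>lborel) * ennreal \<bar>V z\<bar> \<partial>lborel)"
    by (subst nn_integral_multc[symmetric]) (simp_all add: mult_ac)
  also have "\<dots> \<le> (\<integral>\<^sup>+z. (ennreal (104 * t) * (ennreal (heat_g (2 * t) x z) + ennreal (heat_g (2 * t) (x + t *\<^sub>R w) z)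
        + (\<integral>\<^sup>+s\<in>{0..t}. ennreal (1 / sqrt (s * t)) * ennreal (heat_g (2 * t) (x + s *\<^sub>R w) z) \<partial>lborel))) * ennreal \<bar>V z\<bar> \<partial>lborel)"
    using assms by (intro nn_integral_mono mult_right_mono nn_integral_heat_g_drift_le) auto
  also have "\<dots> = (\<integral>\<^sup>+z. ennreal (104 * t) * (ennreal (heat_g (2 * t) x z * \<bar>V z\<bar>) + ennreal (heat_g (2 * t) (x + t *\<^sub>R w) z * \<bar>V z\<bar>)
        + (\<integral>\<^sup>+s. ennreal (1 / sqrt (s * t)) * indicator {0..t} s * ennreal (heat_g (2 * t) (x + s *\<^sub>R w) z * \<bar>V z\<bar>) \<partial>lborel)) \<partial>lborel)"
    (is "_ = (\<integral>\<^sup>+z. _ * (_ + _ + ?I z) \<partial>lborel)")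
  proof (intro nn_integral_cong)
    fix z
    have "(\<integral>\<^sup>+s\<in>{0..t}. ennreal (1 / sqrt (s * t)) * ennreal (heat_g (2 * t) (x + s *\<^sub>R w) z) \<partial>lborel) * ennreal \<bar>V z\<bar> = ?I z"
      by (subst nn_integral_multc[symmetric]) (simp_all add: ennreal_mult mult_ac)
    then show "(ennreal (104 * t) * (ennreal (heat_g (2 * t) x z) + ennreal (heat_g (2 * t) (x + t *\<^sub>R w) z)
        + (\<integral>\<^sup>+s\<in>{0..t}. ennreal (1 / sqrt (s * t)) * ennreal (heat_g (2 * t) (x + s *\<^sub>R w) z) \<partial>lborel))) * ennreal \<bar>V z\<bar>
      = ennreal (104 * t) * (ennreal (heat_g (2 * t) x z * \<bar>V z\<bar>) + ennreal (heat_g (2 * t) (x + t *\<^sub>R w) z * \<bar>V z\<bar>) + ?I z)"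
      by (simp only: mult.assoc distrib_right ennreal_mult[OF heat_g_nonneg abs_ge_zero])
  qed
  also have "\<dots> = ennreal (104 * t) * (pot V (2 * t) x + pot V (2 * t) (x + t *\<^sub>R w) + (\<integral>\<^sup>+z. ?I z \<partial>lborel))"
    unfolding pot_def by (simp add: nn_integral_cmult nn_integral_add)
  also have "(\<integral>\<^sup>+z. ?I z \<partial>lborel) = (\<integral>\<^sup>+s. \<integral>\<^sup>+z. ennreal (1 / sqrt (s * t)) * indicator {0..t} s * ennreal (heat_g (2 * t) (x + s *\<^sub>R w) z * \<bar>V z\<bar>) \<partial>lborel \<partial>lborel)"
    by (rule lborel_pair.Fubini') measurable
  also have "\<dots> = (\<integral>\<^sup>+s. ennreal (1 / sqrt (s * t)) * indicator {0..t} s * pot V (2 * t) (x + s *\<^sub>R w) \<partial>lborel)"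
    unfolding pot_def by (intro nn_integral_cong nn_integral_cmult) measurable
  also have "ennreal (104 * t) * (pot V (2 * t) x + pot V (2 * t) (x + t *\<^sub>R w) + \<dots>)
      \<le> ennreal (104 * t) * (M + M + (\<integral>\<^sup>+s. ennreal (1 / sqrt (s * t)) * indicator {0..t} s * M \<partial>lborel))"
    by (intro mult_left_mono add_mono nn_integral_mono M) auto
  also have "(\<integral>\<^sup>+s. ennreal (1 / sqrt (s * t)) * indicator {0..t} s * M \<partial>lborel) = 2 * M"
    using nn_integral_inverse_sqrt[OF \<open>0 < t\<close>] by (simp add: nn_integral_multc)
  also have "M + M + 2 * M = 4 * M"
    by (simp add: mult_2[symmetric] distrib_right[symmetric])
  also have "ennreal (104 * t) * (4 * M) = ennreal (104 * t * (4 / t)) * (4 * heat_pot V t)"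
    unfolding M_def using \<open>0 < t\<close> by (subst ennreal_mult) (auto simp: mult_ac)
  also have "104 * t * (4 / t) = 416"
    using \<open>0 < t\<close> by simp
  finally show ?thesis
    by (simp add: mult.assoc[symmetric])
qed

lemma nn_integral_pot_drift_le:
  fixes V :: "'a::euclidean_space \<Rightarrow> real"
  assumes V[measurable]: "V \<in> borel_measurable borel" and "0 < t" and dim: "DIM('a) \<in> {1, 2}"
  shows "(\<integral>\<^sup>+s\<in>{0..t / 2}. pot V s (x + s *\<^sub>R w) \<partial>lborel) \<le> 1666 * heat_pot V t"
proof -
  let ?P = "\<lambda>s. pot V s (x + s *\<^sub>R w)"
  consider "DIM('a) = 1" | "DIM('a) = 2" using dim by auto
  then show ?thesis
  proof cases
    case 1
    have "(\<integral>\<^sup>+s\<in>{0..t / 2}. ?P s \<partial>lborel) \<le> (\<integral>\<^sup>+s\<in>{0..t}. ?P s \<partial>lborel)"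
      using \<open>0 < t\<close> by (intro nn_integral_mono) (auto split: split_indicator)
    also have "\<dots> \<le> 16 * heat_pot V t"
      by (rule nn_integral_pot_drift_le_dim1[OF V \<open>0 < t\<close> 1])
    also have "\<dots> \<le> 1666 * heat_pot V t"
      by (intro mult_right_mono) auto
    finally show ?thesis .
  next
    case 2
    have near: "(\<integral>\<^sup>+s\<in>{0..t / 2} \<inter> {s. s * (norm w)\<^sup>2 \<le> 1}. ?P s \<partial>lborel) \<le> 2 * heat_pot V t"
      by (rule nn_integral_pot_drift_le_near[OF V \<open>0 < t\<close> 2])
    show ?thesis
    \<comment> \<open>Without drift the near region is all of \<open>{0..t / 2}\<close>; otherwise
      the near and far regions meet at the inverse square of \<open>norm w\<close> and together
      cover it.\<close>
    proof (cases "w = 0")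
      case True
      with near have "(\<integral>\<^sup>+s\<in>{0..t / 2}. ?P s \<partial>lborel) \<le> 2 * heat_pot V t" by simp
      also have "\<dots> \<le> 1666 * heat_pot V t"
        by (intro mult_right_mono) auto
      finally show ?thesis .
    next
      case False
      have "(\<integral>\<^sup>+s\<in>{0..t / 2}. ?P s \<partial>lborel)
          \<le> (\<integral>\<^sup>+s. ?P s * indicator ({0..t / 2} \<inter> {s. s * (norm w)\<^sup>2 \<le> 1}) s + ?P s * indicator {1 / (norm w)\<^sup>2..t} s \<partial>lborel)"
        using \<open>0 < t\<close> False by (intro nn_integral_mono) (auto split: split_indicator simp: field_simps)
      also have "\<dots> = (\<integral>\<^sup>+s\<in>{0..t / 2} \<inter> {s. s * (norm w)\<^sup>2 \<le> 1}. ?P s \<partial>lborel) + (\<integral>\<^sup>+s\<in>{1 / (norm w)\<^sup>2..t}. ?P s \<partial>lborel)"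
        by (intro nn_integral_add) measurable
      also have "\<dots> \<le> 2 * heat_pot V t + 1664 * heat_pot V t"
        by (intro add_mono near nn_integral_pot_drift_le_far[OF V \<open>0 < t\<close> 2 False])
      also have "\<dots> = 1666 * heat_pot V t"
        by (simp add: distrib_right[symmetric])
      finally show ?thesis .
    qed
  qed
qed

section \<open>Upper bound: the bridge split at half time\<close>

lemma S_fun_le_heat_pot:
  fixes V :: "'a::euclidean_space \<Rightarrow> real"
  assumes V[measurable]: "V \<in> borel_measurable borel" and "0 < t" and dim: "DIM('a) \<in> {1, 2}"
  shows "S_fun V t x y \<le> 6664 * heat_pot V t"
proof -
  define J where "J x y s = (\<integral>\<^sup>+z. ennreal (heat_g s x z * heat_g (t - s) z y / heat_g t x y * \<bar>V z\<bar>) \<partial>lborel)" for x y s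
  have [measurable]: "J x y \<in> borel_measurable borel" for x y
    unfolding J_def by measurable
  have swap: "J x y (t - s) = J y x s" for x y s
    unfolding J_def using bridge_kernel_commute[of "t - s" x _ t y] by (simp add: heat_g_commute mult_ac)
  have half: "(\<integral>\<^sup>+s\<in>{0..t / 2}. J x y s \<partial>lborel) \<le> 3332 * heat_pot V t" for x y
  proof -
    define w where "w = (1 / t) *\<^sub>R (y - x)"
    \<comment> \<open>For \<open>s \<le> t / 2\<close> the bridge time
      \<open>s * (t - s) / t\<close> lies between \<open>s / 2\<close> and \<open>s\<close>, so
      replacing it by \<open>s\<close> costs a factor 2 and leaves the heat kernel with drift
      \<open>w\<close>.\<close>
    have bound: "J x y s \<le> 2 * pot V s (x + s *\<^sub>R w)" if "0 < s" "s \<le> t / 2" for s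
    proof -
      have "s < t" using that \<open>0 < t\<close> by simp
      have "J x y s = pot V (s * (t - s) / t) (x + s *\<^sub>R w)"
        unfolding J_def pot_def heat_g_bridge[OF \<open>0 < s\<close> \<open>s < t\<close>] by (simp add: w_def)
      also have "\<dots> \<le> ennreal 2 * pot V s (x + s *\<^sub>R w)"
      proof (rule pot_mult_le)
        show "heat_g (s * (t - s) / t) (x + s *\<^sub>R w) z \<le> 2 * heat_g s (x + s *\<^sub>R w) z" for z
        proof (rule heat_g_le_dilate)
          show "0 < s * (t - s) / t" using that \<open>s < t\<close> by simp
          show "s * (t - s) / t \<le> s" using that \<open>0 < t\<close> by (simp add: field_simps)
          have "s * t \<le> s * (2 * (t - s))"
            using that by (intro mult_left_mono) auto
          then show "s \<le> 2 * (s * (t - s) / t)" using \<open>0 < t\<close> by (simp add: field_simps)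
          show "DIM('a) \<le> 2" using dim by auto
        qed
      qed auto
      finally show ?thesis by simp
    qed
    have "(\<integral>\<^sup>+s\<in>{0..t / 2}. J x y s \<partial>lborel) \<le> (\<integral>\<^sup>+s. 2 * (pot V s (x + s *\<^sub>R w) * indicator {0..t / 2} s) \<partial>lborel)"
    proof (intro nn_integral_mono)
      fix s
      show "J x y s * indicator {0..t / 2} s \<le> 2 * (pot V s (x + s *\<^sub>R w) * indicator {0..t / 2} s)"
      proof (cases "0 < s \<and> s \<le> t / 2")
        case True
        then show ?thesis using bound by simp
      next
        case False
        have "J x y 0 = 0" by (simp add: J_def heat_g_def)
        with False show ?thesis by (cases "s = 0") auto
      qed
    qed
    also have "\<dots> = 2 * (\<integral>\<^sup>+s\<in>{0..t / 2}. pot V s (x + s *\<^sub>R w) \<partial>lborel)"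
      by (intro nn_integral_cmult) measurable
    also have "\<dots> \<le> 2 * (1666 * heat_pot V t)"
      by (intro mult_left_mono nn_integral_pot_drift_le[OF V \<open>0 < t\<close> dim]) simp
    finally show ?thesis by (simp add: mult.assoc[symmetric])
  qed
  have "S_fun V t x y = (\<integral>\<^sup>+s\<in>{0..t}. J x y s \<partial>lborel)"
    by (simp add: S_fun_def J_def)
  also have "\<dots> \<le> (\<integral>\<^sup>+s. J x y s * indicator {0..t / 2} s + J x y s * indicator {t / 2..t} s \<partial>lborel)"
    by (intro nn_integral_mono) (auto split: split_indicator)
  also have "\<dots> = (\<integral>\<^sup>+s\<in>{0..t / 2}. J x y s \<partial>lborel) + (\<integral>\<^sup>+s\<in>{t / 2..t}. J x y s \<partial>lborel)"
    by (intro nn_integral_add) measurable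
  \<comment> \<open>Substituting \<open>t - s\<close> and using \<open>swap\<close> turns the second
    half into the first half of the reversed bridge. Two halves, each with \<open>2 * 1666\<close>,
    give 6664.\<close>
  also have "(\<integral>\<^sup>+s\<in>{t / 2..t}. J x y s \<partial>lborel) = (\<integral>\<^sup>+s. J x y (t - s) * indicator {t / 2..t} (t - s) \<partial>lborel)"
    using nn_integral_real_affine[of "\<lambda>s. J x y s * indicator {t / 2..t} s" "- 1" t] by simp
  also have "\<dots> = (\<integral>\<^sup>+s\<in>{0..t / 2}. J y x s \<partial>lborel)"
    unfolding swap by (intro nn_integral_cong) (auto split: split_indicator)
  also have "(\<integral>\<^sup>+s\<in>{0..t / 2}. J x y s \<partial>lborel) + \<dots> \<le> 3332 * heat_pot V t + 3332 * heat_pot V t"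
    by (intro add_mono half)
  also have "\<dots> = 6664 * heat_pot V t"
    by (simp add: distrib_right[symmetric])
  finally show ?thesis .
qed

lemma S_norm_le_heat_pot:
  fixes V :: "'a::euclidean_space \<Rightarrow> real"
  assumes "V \<in> borel_measurable borel" "DIM('a) \<in> {1, 2}"
  shows "S_norm V T \<le> 6664 * heat_pot V T"
  unfolding S_norm_def S_sup_def
proof (intro SUP_least)
  fix t x y assume "t \<in> {0<..T}"
  then have "S_fun V t x y \<le> 6664 * heat_pot V t"
    using assms by (intro S_fun_le_heat_pot) auto
  also have "\<dots> \<le> 6664 * heat_pot V T"
    using \<open>t \<in> {0<..T}\<close> by (intro mult_left_mono heat_pot_mono) auto
  finally show "S_fun V t x y \<le> 6664 * heat_pot V T" .
qed

theorem theorem1p6: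
  assumes "DIM('a::euclidean_space) \<in> {1, 2}"
  shows "\<exists>c::real. c > 0 \<and>
    (\<forall>T::real. T > 0 \<longrightarrow> (\<forall>V :: 'a \<Rightarrow> real. V \<in> borel_measurable borel \<longrightarrow>
       ennreal (1 / c) * heat_pot V T \<le> S_norm V T \<and> S_norm V T \<le> ennreal c * heat_pot V T))"
proof (intro exI[of _ 6664] conjI allI impI)
  fix T :: real and V :: "'a \<Rightarrow> real"
  assume "0 < T" and V: "V \<in> borel_measurable borel"
  \<comment> \<open>The lower bound holds with constant 1; it is weakened only so that a single
    \<open>c\<close> serves both sides.\<close>
  have "ennreal (1 / 6664) * heat_pot V T \<le> 1 * heat_pot V T"
    by (intro mult_right_mono) auto
  with heat_pot_le_S_norm[OF V \<open>0 < T\<close>] show "ennreal (1 / 6664) * heat_pot V T \<le> S_norm V T"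
    by simp
  show "S_norm V T \<le> ennreal 6664 * heat_pot V T"
    using S_norm_le_heat_pot[OF V assms] by simp
qed simp

end
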